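(* Let $X$ be a complex Hilbert space. Let $T \in \mathcal{L}(X)$ be power-bounded, and suppose that $S \in \mathcal{L}(X)$ commutes with $T$. Let $\alpha > 0$ and $k \in \mathbb{N}$ satisfy $k > \alpha$. Then the following statements are equivalent: (i) $\|T^nS\| = O(n^{-\alpha})$ as $n \to \infty$. (ii) There exists a constant $M>0$ such that $$\|(\lambda I - T)^{-k} S\| \leq \frac{M}{(|\lambda|-1)^{k-\alpha}}$$ for all $\lambda \in \mathbb{C}$ with $|\lambda| > 1$.
   Context: $\mathcal{L}(X)$ denotes the space of bounded linear operators on $X$. An operator $T \in \mathcal{L}(X)$ is power-bounded if $\sup_{n \ge 0}\|T^n\| < \infty$ (then its spectral radius is at most $1$, so the resolvent exists for $|\lambda|>1$). $\mathbb{N}$ is the set of positive integers. $a(n) = O(b(n))$ as $n\to\infty$ means there are constants $K>0$, $n_0$ with $a(n)\le K b(n)$ for all $n \ge n_0$. *)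

theory Defs
  imports "HOL-Analysis.Analysis" "HOL-Library.Landau_Symbols"
begin

class complex_vector = real_vector +
  fixes scaleC :: "complex \<Rightarrow> 'a \<Rightarrow> 'a" (infixr \<open>*\<^sub>C\<close> 75)
  assumes scaleC_add_right: "a *\<^sub>C (x + y) = a *\<^sub>C x + a *\<^sub>C y"
    and scaleC_add_left: "(a + b) *\<^sub>C x = a *\<^sub>C x + b *\<^sub>C x"
    and scaleC_scaleC: "a *\<^sub>C b *\<^sub>C x = (a * b) *\<^sub>C x"
    and scaleC_of_real: "complex_of_real r *\<^sub>C x = r *\<^sub>R x"

(* The inner product is linear in the first and conjugate-linear in the second argument.
   The norm, metric and topology are the ones it induces: the class real_normed_vector ties distance
   and topology to the norm, and its norm axioms follow from the remaining ones by Cauchy-Schwarz. *)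
class complex_inner = complex_vector + real_normed_vector +
  fixes cinner :: "'a \<Rightarrow> 'a \<Rightarrow> complex"
  assumes cinner_commute: "cinner x y = cnj (cinner y x)"
    and cinner_add_left: "cinner (x + y) z = cinner x z + cinner y z"
    and cinner_scaleC_left: "cinner (a *\<^sub>C x) y = a * cinner x y"
    and cinner_ge_zero: "0 \<le> Re (cinner x x)"
    and cinner_eq_zero_iff: "cinner x x = 0 \<longleftrightarrow> x = 0"
    and norm_eq_sqrt_cinner: "norm x = sqrt (Re (cinner x x))"
begin

lemma cinner_add_right: "cinner x (y + z) = cinner x y + cinner x z"
  by (metis cinner_commute cinner_add_left complex_cnj_add)

lemma cinner_scaleC_right: "cinner x (a *\<^sub>C y) = cnj a * cinner x y"
  by (metis cinner_commute cinner_scaleC_left complex_cnj_mult)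

lemma cinner_self: "cinner x x = complex_of_real ((norm x)\<^sup>2)"
  using cinner_commute[of x x] cinner_ge_zero[of x]
  by (auto simp: complex_eq_iff norm_eq_sqrt_cinner)

lemma norm_scaleC: "norm (a *\<^sub>C x) = cmod a * norm x"
proof -
  have "complex_of_real ((norm (a *\<^sub>C x))\<^sup>2) = complex_of_real ((cmod a * norm x)\<^sup>2)"
    unfolding cinner_self[symmetric] cinner_scaleC_left cinner_scaleC_right power_mult_distrib
      of_real_mult complex_norm_square
    by simp
  then have "(norm (a *\<^sub>C x))\<^sup>2 = (cmod a * norm x)\<^sup>2"
    by (simp only: of_real_eq_iff)
  then show ?thesis
    by (rule power2_eq_imp_eq) simp_all
qed

end

class complex_hilbert_space = complex_inner + complete_space
begin
subclass banach ..
end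

definition bounded_clinear :: "('a::complex_inner \<Rightarrow> 'a) \<Rightarrow> bool" where
  "bounded_clinear T \<longleftrightarrow> bounded_linear T \<and> (\<forall>c x. T (c *\<^sub>C x) = c *\<^sub>C T x)"

definition power_bounded :: "('a::complex_inner \<Rightarrow> 'a) \<Rightarrow> bool" where
  "power_bounded T \<longleftrightarrow> bdd_above (range (\<lambda>n. onorm (T ^^ n)))"

definition resolvent :: "('a::complex_inner \<Rightarrow> 'a) \<Rightarrow> complex \<Rightarrow> 'a \<Rightarrow> 'a" where
  "resolvent T l = inv (\<lambda>x. l *\<^sub>C x - T x)"

lemma bounded_linear_funpow:
  fixes T :: "'a::real_normed_vector \<Rightarrow> 'a"
  assumes "bounded_linear T"
  shows "bounded_linear (T ^^ n)"
proof (induction n)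
  case 0
  show ?case
    using bounded_linear_ident by (simp add: id_def)
next
  case (Suc n)
  then show ?case
    using bounded_linear_compose[OF assms Suc] by (simp add: o_def)
qed

lemma bounded_linear_scaleC: "bounded_linear (\<lambda>x::'a::complex_inner. a *\<^sub>C x)"
proof (rule bounded_linear_intro[where K = "cmod a"])
  fix r :: real and x :: 'a
  show "a *\<^sub>C r *\<^sub>R x = r *\<^sub>R a *\<^sub>C x"
    by (simp add: scaleC_scaleC mult.commute flip: scaleC_of_real)
qed (simp_all add: scaleC_add_right norm_scaleC mult.commute)

(* For a power-bounded operator and a point outside the closed unit disc, the function inverse
   used in the definition of the resolvent is the inverse in the algebra of bounded operators. *)
lemma
  fixes T :: "'a::complex_hilbert_space \<Rightarrow> 'a"
  assumes T: "bounded_clinear T" and pb: "power_bounded T" and l: "cmod l > 1"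
  shows bij_resolvent: "bij (\<lambda>x. l *\<^sub>C x - T x)"
    and bounded_clinear_resolvent: "bounded_clinear (resolvent T l)"
proof -
  let ?A = "\<lambda>x. l *\<^sub>C x - T x"
  have bl: "bounded_linear T" and hom: "T (c *\<^sub>C x) = c *\<^sub>C T x" for c x
    using T by (auto simp: bounded_clinear_def)
  obtain C0 where C0: "onorm (T ^^ n) \<le> C0" for n
    using pb by (auto simp: power_bounded_def bdd_above_def)
  have bd: "norm ((T ^^ n) x) \<le> C0 * norm x" for n x
    using onorm[OF bounded_linear_funpow[OF bl], of n x] C0[of n]
    by (meson mult_right_mono norm_ge_zero order_trans)
  have l0: "l \<noteq> 0" "cmod (inverse l) < 1"
    using l by (auto simp: norm_inverse inverse_less_1_iff)
  define t where "t = (\<lambda>x n. inverse l ^ Suc n *\<^sub>C (T ^^ n) x)"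
  have tb: "norm (t x n) \<le> cmod (inverse l) ^ n * (cmod (inverse l) * C0 * norm x)" for x n
    using mult_left_mono[OF bd[of n x], of "cmod (inverse l) ^ Suc n"]
    by (simp add: t_def norm_scaleC norm_mult norm_power mult_ac)
  have sg: "summable (\<lambda>n. cmod (inverse l) ^ n * (cmod (inverse l) * C0 * norm x))" for x
    using l0 by (intro summable_mult2 summable_geometric) simp
  have sn: "summable (\<lambda>n. norm (t x n))" for x
    by (rule summable_comparison_test'[OF sg]) (use tb in simp)
  then have st: "summable (t x)" for x
    by (rule summable_norm_cancel)
  define R where "R = (\<lambda>x. suminf (t x))"
  have AR: "?A (R x) = x" for x
  proof -
    have one: "1 *\<^sub>C y = y" for y :: 'a
      using scaleC_of_real[of 1 y] by simp
    have blA: "bounded_linear ?A"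
      using bounded_linear_sub[OF bounded_linear_scaleC bl] .
    have "?A (t x n) = inverse l ^ n *\<^sub>C (T ^^ n) x - inverse l ^ Suc n *\<^sub>C (T ^^ Suc n) x" for n
      using l0 by (simp add: t_def hom scaleC_scaleC flip: mult.assoc)
    moreover have "(\<lambda>n. inverse l ^ n *\<^sub>C (T ^^ n) x) \<longlonglongrightarrow> 0"
    proof -
      have "(\<lambda>n. l *\<^sub>C t x n) \<longlonglongrightarrow> l *\<^sub>C 0"
        by (intro bounded_linear.tendsto[OF bounded_linear_scaleC] summable_LIMSEQ_zero st)
      moreover have "l *\<^sub>C (0::'a) = 0"
        using linear_0[OF bounded_linear.linear[OF bounded_linear_scaleC]] .
      ultimately show ?thesis
        using l0 by (simp add: t_def scaleC_scaleC flip: mult.assoc)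
    qed
    from telescope_sums'[OF this]
    have "(\<lambda>n. inverse l ^ n *\<^sub>C (T ^^ n) x - inverse l ^ Suc n *\<^sub>C (T ^^ Suc n) x) sums x"
      by (simp add: one)
    ultimately have "(\<lambda>n. ?A (t x n)) sums x"
      by (simp only:)
    moreover have "(\<lambda>n. ?A (t x n)) sums ?A (R x)"
      unfolding R_def by (rule bounded_linear.sums[OF blA]) (rule summable_sums[OF st])
    ultimately show ?thesis
      by (rule sums_unique2[symmetric])
  qed
  have R_add: "R (x + y) = R x + R y" for x y
  proof -
    have "t (x + y) = (\<lambda>n. t x n + t y n)"
      using linear_add[OF bounded_linear.linear[OF bounded_linear_funpow[OF bl]]]
      by (simp add: t_def scaleC_add_right fun_eq_iff)
    then show ?thesis
      using suminf_add[OF st st, of x y] by (simp add: R_def)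
  qed
  have homn: "(T ^^ n) (c *\<^sub>C x) = c *\<^sub>C (T ^^ n) x" for n c x
    by (induction n) (auto simp: hom)
  have R_scale: "R (c *\<^sub>C x) = c *\<^sub>C R x" for c x
  proof -
    have "t (c *\<^sub>C x) = (\<lambda>n. c *\<^sub>C t x n)"
      by (simp add: t_def homn scaleC_scaleC mult_ac fun_eq_iff)
    then show ?thesis
      using bounded_linear.suminf[OF bounded_linear_scaleC st, of c x]
      by (simp add: R_def)
  qed
  have "bounded_linear R"
  proof (rule bounded_linear_intro[where K = "(\<Sum>n. cmod (inverse l) ^ n) * (cmod (inverse l) * C0)"])
    fix x y :: 'a and r :: real
    show "R (x + y) = R x + R y" by (rule R_add)
    show "R (r *\<^sub>R x) = r *\<^sub>R R x"
      using R_scale[of "complex_of_real r" x] by (simp add: scaleC_of_real)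
    have "norm (R x) \<le> (\<Sum>n. norm (t x n))"
      unfolding R_def by (rule summable_norm[OF sn])
    also have "\<dots> \<le> (\<Sum>n. cmod (inverse l) ^ n * (cmod (inverse l) * C0 * norm x))"
      by (rule suminf_le[OF tb sn sg])
    also have "\<dots> = (\<Sum>n. cmod (inverse l) ^ n) * (cmod (inverse l) * C0 * norm x)"
      using l0 by (intro suminf_mult2[symmetric] summable_geometric) simp
    finally show "norm (R x) \<le> norm x * ((\<Sum>n. cmod (inverse l) ^ n) * (cmod (inverse l) * C0))"
      by (simp add: mult_ac)
  qed
  with R_scale have R_bc: "bounded_clinear R"
    by (simp add: bounded_clinear_def)
  have RA: "R (?A x) = x" for x
  proof -
    have "(T ^^ n) (T x) = T ((T ^^ n) x)" for n x
      by (simp flip: funpow_swap1)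
    then have "t (T x) = (\<lambda>n. T (t x n))"
      by (simp add: t_def hom fun_eq_iff)
    then have RT: "R (T x) = T (R x)"
      using bounded_linear.suminf[OF bl st, of x] by (simp add: R_def)
    have "R (?A x) = R (l *\<^sub>C x) - R (T x)"
      by (rule linear_diff[OF bounded_linear.linear]) fact
    also have "\<dots> = ?A (R x)"
      by (simp add: R_scale RT)
    finally show ?thesis
      by (simp add: AR)
  qed
  show "bij ?A"
    by (rule bij_betw_byWitness[where f' = R]) (auto simp: RA AR)
  have "inv ?A = R"
    by (rule inv_unique_comp) (auto simp: fun_eq_iff RA AR)
  with R_bc show "bounded_clinear (resolvent T l)"
    by (simp add: resolvent_def)
qed

end

theory Submission
  imports Defs
begin

text \<open>
  Let \<open>c b n\<close> denote the Taylor coefficients of \<open>(1 - z) powr (- b)\<close>; they grow like \<open>n powr (b - 1)\<close>,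
  and the \<open>k\<close>-th power of the resolvent at \<open>l\<close> is the sum of \<open>c k n * l^(-n-k) * T^n\<close>.

  If the norm of \<open>T^n S\<close> is \<open>O(n powr (- \<alpha>))\<close>, then \<open>c k n\<close> times that norm is
  \<open>O(c (k - \<alpha>) n)\<close>, and summing the series gives the resolvent estimate.

  Conversely, let \<open>R\<close> be the resolvent. On the circle of radius \<open>r = 1 + 1/N\<close> the vector
  \<open>R^(k+1) S x = (R^k S) (R x)\<close> is pointwise at most \<open>M * N powr (k - \<alpha>)\<close> times \<open>R x\<close> in norm.
  By Plancherel, which is where the Hilbert space enters, the same comparison holds for the square
  sums of the coefficients \<open>c (k+1) n * T^n S x\<close> and \<open>T^n x\<close>, the latter being \<open>O(N)\<close> because
  \<open>T\<close> is power-bounded. Power-boundedness also bounds \<open>T^N S x\<close> by each \<open>T^n S x\<close> with \<open>n \<le> N\<close>, so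
  summing over \<open>n\<close> with the weights \<open>c (k+1) n\<close>, whose total is \<open>c (k+2) N\<close>, and applying the
  Cauchy-Schwarz inequality yields the decay of \<open>T^N S\<close>.
\<close>

section \<open>Taylor coefficients of negative powers of 1 - z\<close>

definition rising_coeff :: "real \<Rightarrow> nat \<Rightarrow> real" where
  "rising_coeff b n = pochhammer b n / fact n"

lemma rising_coeff_0 [simp]: "rising_coeff b 0 = 1"
  by (simp add: rising_coeff_def)

lemma rising_coeff_0_Suc [simp]: "rising_coeff 0 (Suc n) = 0"
  by (simp add: rising_coeff_def pochhammer_rec)

lemma rising_coeff_1 [simp]: "rising_coeff 1 n = 1"
  by (simp add: rising_coeff_def flip: pochhammer_fact)

lemma rising_coeff_pos: "b > 0 \<Longrightarrow> rising_coeff b n > 0"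
  by (simp add: rising_coeff_def pochhammer_pos)

lemma rising_coeff_nonneg: "b \<ge> 0 \<Longrightarrow> rising_coeff b n \<ge> 0"
  by (cases "b = 0"; cases n) (simp_all add: less_imp_le rising_coeff_pos)

text \<open>Coefficient comparison in
  \<open>(1 - z) * (1 - z) powr (- b - 1) = (1 - z) powr (- b)\<close>. It drives both the summation
  of the weights and the induction on the power of the resolvent.\<close>

lemma rising_coeff_pascal:
  "rising_coeff (b + 1) (Suc n) = rising_coeff (b + 1) n + rising_coeff b (Suc n)"
proof -
  have "pochhammer (b + 1) (Suc n) = pochhammer (b + 1) n * (b + 1 + real n)"
    and "pochhammer b (Suc n) = b * pochhammer (b + 1) n"
    by (rule pochhammer_Suc) (rule pochhammer_rec)
  then show ?thesis
    by (simp add: rising_coeff_def divide_simps) (simp add: algebra_simps)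
qed

lemma sum_rising_coeff: "(\<Sum>n<Suc N. rising_coeff b n) = rising_coeff (b + 1) N"
  by (induction N) (simp_all add: rising_coeff_pascal)

lemma rising_coeff_sums:
  assumes "\<bar>z\<bar> < 1"
  shows "(\<lambda>n. rising_coeff b n * z ^ n) sums (1 - z) powr (- b)"
proof -
  have "(- b gchoose n) * (- z) ^ n = rising_coeff b n * z ^ n" for n
    using power_minus[of z n] by (simp add: rising_coeff_def gbinomial_pochhammer)
  then show ?thesis
    using gen_binomial_real[of "- z" "- b"] assms by simp
qed

text \<open>By the limit formula for Gamma, the quotient tends to \<open>inverse (Gamma b)\<close>,
  which is nonzero for positive \<open>b\<close>.\<close>

lemma rising_coeff_bigtheta:
  assumes "b > 0"
  shows "rising_coeff b \<in> \<Theta>(\<lambda>n. real n powr (b - 1))"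
proof (rule bigthetaI_tendsto)
  show "inverse (Gamma b) \<noteq> 0"
    using Gamma_real_pos[OF assms] by simp
  \<comment> \<open>Index 0 has to be left out: there \<open>powr\<close> is 0 by convention, while
    \<open>exp\<close> never vanishes.\<close>
  have "(- b gchoose n) / ((-1) ^ n / exp ((- b + 1) * of_real (ln (real n))))
      = rising_coeff b n / real n powr (b - 1)" if "n > 0" for n
    using that by (simp add: rising_coeff_def gbinomial_pochhammer powr_def exp_minus[symmetric]
      divide_simps exp_add[symmetric] algebra_simps)
  then have "\<forall>\<^sub>F n in sequentially. (- b gchoose n) / ((-1) ^ n / exp ((- b + 1) * of_real (ln (real n))))
      = rising_coeff b n / real n powr (b - 1)"
    by (intro eventually_sequentiallyI[of 1]) auto
  from tendsto_cong[OF this]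
  show "(\<lambda>n. rising_coeff b n / real n powr (b - 1)) \<longlonglongrightarrow> inverse (Gamma b)"
    using gbinomial_asymptotic[of "- b"] by simp
qed

text \<open>Positivity of \<open>g\<close> lets the constant absorb the finitely many exceptional
  indices, so that series can be estimated term by term from index 0 on.\<close>

lemma bigo_imp_bounded_all:
  fixes f g :: "nat \<Rightarrow> real"
  assumes "f \<in> O(g)" and "\<And>n. g n > 0"
  obtains A where "A > 0" and "\<And>n. \<bar>f n\<bar> \<le> A * g n"
proof -
  obtain c where "c > 0" "\<forall>\<^sub>F n in sequentially. norm (f n) \<le> c * norm (g n)"
    using assms(1) by (elim landau_o.bigE)
  then have "Bseq (\<lambda>n. f n / g n)"
    using assms(2) by (intro BfunI[where K = c]) (auto elim!: eventually_mono simp: divide_simps abs_of_pos)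
  then obtain A where "A > 0" "\<And>n. norm (f n / g n) \<le> A"
    by (auto simp: Bseq_def)
  then show thesis
    using that[of A] assms(2) by (simp add: divide_simps abs_of_pos mult.commute)
qed

section \<open>A Plancherel comparison\<close>

lemma scaleC_one [simp]: "1 *\<^sub>C (x::'a::complex_inner) = x"
  using scaleC_of_real[of 1 x] by simp

text \<open>The sum is geometric with a ratio \<open>q\<close> satisfying \<open>q ^ N = 1\<close>,
  so it vanishes unless \<open>q = 1\<close>; distinctness of the powers of \<open>w\<close> below
  \<open>N\<close> reduces that case to \<open>n = p\<close>.\<close>

lemma sum_roots_of_unity_orthogonal:
  fixes N n p :: nat
  defines "w \<equiv> cis (2 * pi / real N)"
  assumes "n < N" "p < N"
  shows "(\<Sum>j<N. (w ^ j) ^ n * cnj ((w ^ j) ^ p)) = (if n = p then of_nat N else 0)"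
proof -
  define q where "q = w ^ n * cnj (w ^ p)"
  have unit: "w ^ m * cnj (w ^ m) = 1" for m
    unfolding complex_norm_square[symmetric] by (simp add: w_def norm_power)
  have geo: "(\<Sum>j<N. (w ^ j) ^ n * cnj ((w ^ j) ^ p)) = (\<Sum>j<N. q ^ j)"
    by (simp add: q_def power_mult_distrib mult.commute flip: power_mult)
  have "w ^ N = 1"
    using assms(2) unfolding w_def Complex.DeMoivre by simp
  then have qN: "q ^ N = 1"
    by (simp add: q_def power_mult_distrib power_mult[symmetric] mult.commute[of _ N])
       (simp add: power_mult flip: complex_cnj_power)
  have "q = 1 \<longleftrightarrow> n = p"
  proof
    assume "q = 1"
    then have "w ^ n * (w ^ p * cnj (w ^ p)) = w ^ p"
      unfolding q_def by (metis mult.left_commute mult.right_neutral)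
    then have "w ^ n = w ^ p"
      by (simp only: unit mult_1_right)
    then have "cis (2 * pi * real n / real N) = cis (2 * pi * real p / real N)"
      by (simp add: w_def Complex.DeMoivre mult_ac)
    moreover have "inj_on (\<lambda>k. cis (2 * pi * real k / real N)) {..<N}"
      using Complex.bij_betw_roots_unity[of N] assms by (auto simp: bij_betw_def)
    ultimately show "n = p"
      using assms by (auto dest: inj_onD)
  qed (use unit in \<open>simp add: q_def\<close>)
  then show ?thesis
    using qN geometric_sum[of q N] unfolding geo by auto
qed

lemma cinner_sum_left: "cinner (\<Sum>i\<in>A. f i) (y::'a::complex_inner) = (\<Sum>i\<in>A. cinner (f i) y)"
proof -
  have "cinner 0 y = 0"
    using cinner_add_left[of 0 0 y] by simp
  then show ?thesis
    by (induction A rule: infinite_finite_induct) (simp_all add: cinner_add_left)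
qed

lemma cinner_sum_right: "cinner (y::'a::complex_inner) (\<Sum>i\<in>A. f i) = (\<Sum>i\<in>A. cinner y (f i))"
  using arg_cong[OF cinner_sum_left[of f A y], of cnj] by (simp flip: cinner_commute)

text \<open>Expanding the squared norms into inner products leaves only the diagonal terms, by
  orthogonality of the roots of unity.\<close>

lemma discrete_parseval:
  fixes v :: "nat \<Rightarrow> 'a::complex_inner" and N :: nat
  defines "w \<equiv> cis (2 * pi / real N)"
  shows "(\<Sum>j<N. (norm (\<Sum>n<N. (w ^ j) ^ n *\<^sub>C v n))\<^sup>2) = real N * (\<Sum>n<N. (norm (v n))\<^sup>2)"
proof -
  have "complex_of_real (\<Sum>j<N. (norm (\<Sum>n<N. (w ^ j) ^ n *\<^sub>C v n))\<^sup>2)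
      = (\<Sum>j<N. \<Sum>n<N. \<Sum>p<N. (w ^ j) ^ n * cnj ((w ^ j) ^ p) * cinner (v n) (v p))"
    by (simp only: of_real_sum flip: cinner_self)
       (simp only: cinner_sum_left, simp add: cinner_sum_right cinner_scaleC_left
          cinner_scaleC_right sum_distrib_left mult_ac)
  also have "\<dots> = (\<Sum>n<N. \<Sum>j<N. \<Sum>p<N. (w ^ j) ^ n * cnj ((w ^ j) ^ p) * cinner (v n) (v p))"
    by (rule sum.swap)
  also have "\<dots> = (\<Sum>n<N. \<Sum>p<N. (\<Sum>j<N. (w ^ j) ^ n * cnj ((w ^ j) ^ p)) * cinner (v n) (v p))"
    unfolding sum_distrib_right by (intro sum.cong refl sum.swap)
  also have "\<dots> = (\<Sum>n<N. \<Sum>p<N. (if n = p then of_nat N else 0) * cinner (v n) (v p))"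
    unfolding w_def by (intro sum.cong refl) (simp only: sum_roots_of_unity_orthogonal lessThan_iff)
  also have "\<dots> = (\<Sum>n<N. of_nat N * cinner (v n) (v n))"
    by (intro sum.cong refl) (simp add: if_distrib[of "\<lambda>c. c * _"] cong: if_cong)
  also have "\<dots> = complex_of_real (real N * (\<Sum>n<N. (norm (v n))\<^sup>2))"
    by (simp add: cinner_self sum_distrib_left)
  finally show ?thesis
    by (simp only: of_real_eq_iff)
qed

text \<open>Keeping \<open>g\<close> separate from \<open>f\<close> makes the tail bound uniform
  over the unit circle: factors \<open>z ^ n\<close> of modulus 1 change \<open>f\<close> but not
  \<open>g\<close>.\<close>

lemma norm_suminf_minus_sum_le:
  fixes f :: "nat \<Rightarrow> 'a::banach"
  assumes "\<And>n. norm (f n) = g n" and "summable g"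
  shows "norm (suminf f - (\<Sum>n<m. f n)) \<le> suminf g - (\<Sum>n<m. g n)"
proof -
  have sn: "summable (\<lambda>n. norm (f n))"
    using assms by simp
  have "norm (\<Sum>n. f (n + m)) \<le> (\<Sum>n. norm (f (n + m)))"
    using sn by (intro summable_norm summable_ignore_initial_segment)
  then show ?thesis
    using suminf_minus_initial_segment[OF summable_norm_cancel[OF sn], of m]
      suminf_minus_initial_segment[OF assms(2), of m] assms(1)
    by simp
qed

text \<open>Averaging over the roots of unity of order \<open>m\<close> is exact on partial sums of length \<open>m\<close>, so
  Parseval's identity is needed only for finite sums, and the tails vanish as \<open>m\<close> grows.\<close>

lemma plancherel_comparison:
  fixes u v :: "nat \<Rightarrow> 'a::complex_hilbert_space"
  assumes su: "summable (\<lambda>n. norm (u n))" and sv: "summable (\<lambda>n. norm (v n))"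
    and B: "B \<ge> 0"
    and le: "\<And>z. cmod z = 1 \<Longrightarrow> norm (\<Sum>n. z ^ n *\<^sub>C v n) \<le> B * norm (\<Sum>n. z ^ n *\<^sub>C u n)"
    and U: "\<And>m. (\<Sum>n<m. (norm (u n))\<^sup>2) \<le> U"
  shows "(\<Sum>n<N. (norm (v n))\<^sup>2) \<le> B\<^sup>2 * U"
proof -
  \<comment> \<open>The tails \<open>du\<close> and \<open>dv\<close> bound the truncation errors
    for all unimodular \<open>z\<close> at once; \<open>d\<close> is the resulting error in the
    comparison of the partial sums.\<close>
  define du where "du = (\<lambda>m. (\<Sum>n. norm (u n)) - (\<Sum>n<m. norm (u n)))"
  define dv where "dv = (\<lambda>m. (\<Sum>n. norm (v n)) - (\<Sum>n<m. norm (v n)))"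
  define d where "d = (\<lambda>m. B * du m + dv m)"
  define G where "G = (\<Sum>n. norm (u n))"
  have "du \<longlonglongrightarrow> G - G" "dv \<longlonglongrightarrow> (\<Sum>n. norm (v n)) - (\<Sum>n. norm (v n))"
    unfolding du_def dv_def G_def by (intro tendsto_intros summable_LIMSEQ su sv)+
  then have dlim: "d \<longlonglongrightarrow> B * 0 + 0"
    unfolding d_def by (intro tendsto_intros) simp_all
  have dpos: "du m \<ge> 0" "dv m \<ge> 0" for m
    unfolding du_def dv_def using sum_le_suminf[OF su, of "{..<m}"] sum_le_suminf[OF sv, of "{..<m}"]
    by auto
  then have d0: "d m \<ge> 0" for m
    using B by (simp add: d_def)
  \<comment> \<open>The error left after squaring \<open>B * F + d m\<close>, where the partial sum
    norm \<open>F\<close> is at most \<open>G\<close>.\<close>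
  define e where "e = (\<lambda>m. 2 * B * G * d m + (d m)\<^sup>2)"
  have elim: "e \<longlonglongrightarrow> 2 * B * G * (B * 0 + 0) + (B * 0 + 0)\<^sup>2"
    unfolding e_def by (intro tendsto_intros dlim)
  have pointwise: "(norm (\<Sum>n<m. z ^ n *\<^sub>C v n))\<^sup>2 \<le> B\<^sup>2 * (norm (\<Sum>n<m. z ^ n *\<^sub>C u n))\<^sup>2 + e m"
    if z: "cmod z = 1" for z m
  proof -
    let ?F = "norm (\<Sum>n<m. z ^ n *\<^sub>C u n)" and ?H = "norm (\<Sum>n<m. z ^ n *\<^sub>C v n)"
    have nz: "norm (z ^ n *\<^sub>C x) = norm x" for n and x :: 'a
      using z by (simp add: norm_scaleC norm_power)
    have FG: "?F \<le> G"
    proof -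
      have "?F \<le> (\<Sum>n<m. norm (u n))"
        by (rule order_trans[OF norm_sum]) (simp add: nz)
      then show ?thesis
        using dpos(1)[of m] by (simp add: du_def G_def)
    qed
    have "norm ((\<Sum>n. z ^ n *\<^sub>C u n) - (\<Sum>n<m. z ^ n *\<^sub>C u n)) \<le> du m"
      "norm ((\<Sum>n. z ^ n *\<^sub>C v n) - (\<Sum>n<m. z ^ n *\<^sub>C v n)) \<le> dv m"
      unfolding du_def dv_def using nz su sv by (intro norm_suminf_minus_sum_le; simp)+
    then have "norm (\<Sum>n. z ^ n *\<^sub>C u n) \<le> ?F + du m" "?H \<le> norm (\<Sum>n. z ^ n *\<^sub>C v n) + dv m"
      by (norm, norm)
    moreover from this(1) have "B * norm (\<Sum>n. z ^ n *\<^sub>C u n) \<le> B * (?F + du m)"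
      using B by (rule mult_left_mono)
    ultimately have "?H \<le> B * ?F + d m"
      using le[OF z] by (simp add: d_def algebra_simps)
    then have "?H\<^sup>2 \<le> (B * ?F + d m)\<^sup>2"
      by (rule power_mono) simp
    also have "\<dots> = B\<^sup>2 * ?F\<^sup>2 + (2 * B * d m * ?F + (d m)\<^sup>2)"
      by (simp add: power2_eq_square algebra_simps)
    also have "2 * B * d m * ?F \<le> 2 * B * d m * G"
      using FG B d0[of m] by (intro mult_left_mono) auto
    finally show ?thesis
      by (simp add: e_def mult_ac)
  qed
  \<comment> \<open>Here \<open>m\<close> is at least 1 to allow division by \<open>m\<close>, and
    at least \<open>N\<close> so that Parseval covers the first \<open>N\<close> terms.\<close>
  have bound: "(\<Sum>n<N. (norm (v n))\<^sup>2) \<le> B\<^sup>2 * U + e m" if "m \<ge> max 1 N" for m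
  proof -
    define w where "w = cis (2 * pi / real m)"
    have w: "cmod (w ^ j) = 1" for j
      by (simp add: w_def norm_power)
    have "real m * (\<Sum>n<m. (norm (v n))\<^sup>2) = (\<Sum>j<m. (norm (\<Sum>n<m. (w ^ j) ^ n *\<^sub>C v n))\<^sup>2)"
      unfolding w_def by (rule discrete_parseval[symmetric])
    also have "\<dots> \<le> (\<Sum>j<m. B\<^sup>2 * (norm (\<Sum>n<m. (w ^ j) ^ n *\<^sub>C u n))\<^sup>2 + e m)"
      by (intro sum_mono pointwise w)
    also have "\<dots> = B\<^sup>2 * (\<Sum>j<m. (norm (\<Sum>n<m. (w ^ j) ^ n *\<^sub>C u n))\<^sup>2) + real m * e m"
      by (simp add: sum.distrib sum_distrib_left)
    also have "\<dots> = real m * (B\<^sup>2 * (\<Sum>n<m. (norm (u n))\<^sup>2) + e m)"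
      unfolding w_def discrete_parseval by (simp add: algebra_simps)
    finally have "(\<Sum>n<m. (norm (v n))\<^sup>2) \<le> B\<^sup>2 * (\<Sum>n<m. (norm (u n))\<^sup>2) + e m"
      using that by simp
    moreover have "B\<^sup>2 * (\<Sum>n<m. (norm (u n))\<^sup>2) \<le> B\<^sup>2 * U"
      by (intro mult_left_mono U) simp
    moreover have "(\<Sum>n<N. (norm (v n))\<^sup>2) \<le> (\<Sum>n<m. (norm (v n))\<^sup>2)"
      using that by (intro sum_mono2) auto
    ultimately show ?thesis
      by linarith
  qed
  have "(\<lambda>m. B\<^sup>2 * U + e m) \<longlonglongrightarrow> B\<^sup>2 * U + 0"
    using elim by (intro tendsto_intros) simp
  then have "(\<Sum>n<N. (norm (v n))\<^sup>2) \<le> B\<^sup>2 * U + 0"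
    by (rule LIMSEQ_le_const) (use bound in blast)
  then show ?thesis
    by simp
qed

section \<open>Powers of the resolvent\<close>

lemma power_bounded_norm_le:
  assumes "bounded_linear T" and "power_bounded T"
  obtains C where "C > 0" and "\<And>n x. norm ((T ^^ n) x) \<le> C * norm x"
proof -
  obtain C where C: "onorm (T ^^ n) \<le> C" for n
    using assms(2) by (auto simp: power_bounded_def bdd_above_def)
  have "norm ((T ^^ n) x) \<le> max 1 C * norm x" for n x
    by (rule order_trans[OF onorm[OF bounded_linear_funpow[OF assms(1)]]])
       (use C[of n] in \<open>intro mult_right_mono; simp\<close>)
  then show thesis
    using that[of "max 1 C"] by simp
qed

lemma resolvent_eqI:
  fixes T :: "'a::complex_hilbert_space \<Rightarrow> 'a"
  assumes "bounded_clinear T" "power_bounded T" "cmod l > 1" "l *\<^sub>C w - T w = y"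
  shows "resolvent T l y = w"
  using inv_f_eq[OF bij_is_inj[OF bij_resolvent[OF assms(1-3)]] assms(4)] by (simp add: resolvent_def)

lemma resolvent_inverse:
  fixes T :: "'a::complex_hilbert_space \<Rightarrow> 'a"
  assumes "bounded_clinear T" "power_bounded T" "cmod l > 1"
  shows "l *\<^sub>C resolvent T l y - T (resolvent T l y) = y"
  using surj_f_inv_f[OF bij_is_surj[OF bij_resolvent[OF assms]], of y] by (simp add: resolvent_def)

text \<open>Applying \<open>S\<close> to the equation solved by \<open>resolvent T l x\<close>
  yields the equation that determines \<open>resolvent T l (S x)\<close>.\<close>

lemma resolvent_commute:
  fixes T S :: "'a::complex_hilbert_space \<Rightarrow> 'a"
  assumes T: "bounded_clinear T" "power_bounded T" "cmod l > 1"
    and S: "bounded_clinear S" "S \<circ> T = T \<circ> S"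
  shows "resolvent T l (S x) = S (resolvent T l x)"
proof (rule resolvent_eqI[OF T])
  have "linear S" "\<And>c y. S (c *\<^sub>C y) = c *\<^sub>C S y"
    using S(1) by (auto simp: bounded_clinear_def bounded_linear.linear)
  moreover have "S (T y) = T (S y)" for y
    using fun_cong[OF S(2), of y] by simp
  ultimately show "l *\<^sub>C S (resolvent T l x) - T (S (resolvent T l x)) = S x"
    using resolvent_inverse[OF T, of x] linear_diff[of S] by metis
qed

definition resolvent_term :: "('a::complex_inner \<Rightarrow> 'a) \<Rightarrow> nat \<Rightarrow> complex \<Rightarrow> 'a \<Rightarrow> nat \<Rightarrow> 'a" where
  "resolvent_term T k l x n =
    (complex_of_real (rising_coeff (real k) n) * inverse l ^ (n + k)) *\<^sub>C (T ^^ n) x"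

lemma norm_resolvent_term:
  "norm (resolvent_term T k l x n) =
    rising_coeff (real k) n * inverse (cmod l) ^ (n + k) * norm ((T ^^ n) x)"
  by (simp add: resolvent_term_def norm_scaleC norm_mult norm_power norm_inverse
      abs_of_nonneg rising_coeff_nonneg)

lemma summable_norm_resolvent_term:
  assumes "bounded_linear T" and "power_bounded T" and l: "cmod l > 1"
  shows "summable (\<lambda>n. norm (resolvent_term T k l x n))"
proof -
  obtain C where C: "\<And>n x. norm ((T ^^ n) x) \<le> C * norm x"
    using power_bounded_norm_le[OF assms(1,2)] by metis
  let ?q = "inverse (cmod l)"
  have "\<bar>?q\<bar> < 1"
    using l by (simp add: inverse_less_1_iff)
  then have "summable (\<lambda>n. rising_coeff (real k) n * ?q ^ n)"
    using rising_coeff_sums sums_summable by blast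
  then have "summable (\<lambda>n. rising_coeff (real k) n * ?q ^ n * (?q ^ k * (C * norm x)))"
    by (rule summable_mult2)
  then show ?thesis
  proof (rule summable_comparison_test')
    fix n :: nat
    have "rising_coeff (real k) n * ?q ^ (n + k) * norm ((T ^^ n) x)
        \<le> rising_coeff (real k) n * ?q ^ (n + k) * (C * norm x)"
      by (intro mult_left_mono C mult_nonneg_nonneg rising_coeff_nonneg) auto
    then show "norm (norm (resolvent_term T k l x n))
        \<le> rising_coeff (real k) n * ?q ^ n * (?q ^ k * (C * norm x))"
      by (simp only: real_norm_def abs_norm_cancel) (simp add: norm_resolvent_term power_add mult_ac)
  qed
qed

text \<open>Induction on \<open>k\<close>: multiplying the series for \<open>Suc k\<close> by
  \<open>l - T\<close> gives the series for \<open>k\<close>, coefficient by coefficient, by the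
  Pascal rule. Uniqueness of the solution then identifies its sum.\<close>

lemma resolvent_power_sums:
  fixes T :: "'a::complex_hilbert_space \<Rightarrow> 'a"
  assumes T: "bounded_clinear T" "power_bounded T" and l: "cmod l > 1"
  shows "resolvent_term T k l x sums (resolvent T l ^^ k) x"
proof (induction k)
  case 0
  have "resolvent_term T 0 l x n = 0" if n: "n \<notin> {0}" for n
  proof -
    obtain m where "n = Suc m"
      using n by (cases n) auto
    then show ?thesis
      using scaleC_of_real[of 0] by (simp add: resolvent_term_def)
  qed
  then have "resolvent_term T 0 l x sums (\<Sum>n\<in>{0}. resolvent_term T 0 l x n)"
    by (intro sums_finite) auto
  then show ?case
    by (simp add: resolvent_term_def[of _ _ _ _ 0])
next
  case (Suc k)
  have bl: "bounded_linear T" and hom: "T (c *\<^sub>C y) = c *\<^sub>C T y" for c y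
    using T by (auto simp: bounded_clinear_def)
  have l0: "l \<noteq> 0"
    using l by auto
  define t where "t = resolvent_term T (Suc k) l x"
  define w where "w = suminf t"
  have tw: "t sums w"
    unfolding t_def w_def
    by (rule summable_sums[OF summable_norm_cancel[OF summable_norm_resolvent_term[OF bl T(2) l]]])
  have lt: "(\<lambda>n. l *\<^sub>C t n) sums (l *\<^sub>C w)"
    by (rule bounded_linear.sums[OF bounded_linear_scaleC tw])
  \<comment> \<open>A zero is prepended so that index \<open>n\<close> carries \<open>T ^^ n\<close>
    here as well and the two series can be subtracted termwise.\<close>
  have Tt: "(\<lambda>n. case n of 0 \<Rightarrow> 0 | Suc m \<Rightarrow> T (t m)) sums T w"
    using bounded_linear.sums[OF bl tw] sums_Suc[of "\<lambda>n. case n of 0 \<Rightarrow> 0 | Suc m \<Rightarrow> T (t m)" "T w"]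
    by simp
  have "l *\<^sub>C t n - (case n of 0 \<Rightarrow> 0 | Suc m \<Rightarrow> T (t m)) = resolvent_term T k l x n" for n
  proof (cases n)
    case 0
    then show ?thesis
      using l0 by (simp add: t_def resolvent_term_def scaleC_scaleC flip: mult.assoc)
  next
    case (Suc m)
    let ?y = "(T ^^ Suc m) x" and ?i = "inverse l ^ (Suc m + k)"
    have "l *\<^sub>C t n = (complex_of_real (rising_coeff (real k + 1) (Suc m)) * ?i) *\<^sub>C ?y"
    proof -
      have "l * (c * inverse l ^ (Suc m + Suc k)) = c * ?i" for c
        using l0 by (simp add: field_simps)
      then show ?thesis
        using Suc by (simp only: t_def resolvent_term_def scaleC_scaleC) (simp add: add.commute)
    qed
    moreover have "T (t m) = (complex_of_real (rising_coeff (real k + 1) m) * ?i) *\<^sub>C ?y"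
      by (simp add: t_def resolvent_term_def hom add.commute)
    moreover have "resolvent_term T k l x n = (complex_of_real (rising_coeff (real k) (Suc m)) * ?i) *\<^sub>C ?y"
      using Suc by (simp add: resolvent_term_def)
    ultimately show ?thesis
      using Suc by (simp add: rising_coeff_pascal ring_distribs scaleC_add_left)
  qed
  then have "resolvent_term T k l x sums (l *\<^sub>C w - T w)"
    using sums_diff[OF lt Tt] by simp
  then have "l *\<^sub>C w - T w = (resolvent T l ^^ k) x"
    using Suc.IH sums_unique2 by blast
  then have "resolvent T l ((resolvent T l ^^ k) x) = w"
    by (intro resolvent_eqI T l)
  then show ?case
    using tw by (simp add: t_def)
qed

text \<open>Passing from \<open>r\<close> to \<open>r / z\<close> multiplies the \<open>n\<close>-th
  term by \<open>z ^ (n + k)\<close>, and the factor \<open>z ^ k\<close> is invisible to the norm.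
  Resolvent bounds on the circle of radius \<open>r\<close> thus become the pointwise hypothesis of
  the Plancherel comparison.\<close>

lemma norm_resolvent_power_on_circle:
  fixes T :: "'a::complex_hilbert_space \<Rightarrow> 'a"
  assumes T: "bounded_clinear T" "power_bounded T" and r: "r > 1" and z: "cmod z = 1"
  shows "norm (\<Sum>n. z ^ n *\<^sub>C resolvent_term T k (complex_of_real r) x n)
    = norm ((resolvent T (complex_of_real r / z) ^^ k) x)"
proof -
  let ?t = "resolvent_term T k (complex_of_real r) x"
  have bl: "bounded_linear T"
    using T by (simp add: bounded_clinear_def)
  have "summable (\<lambda>n. norm (z ^ n *\<^sub>C ?t n))"
    using summable_norm_resolvent_term[OF bl T(2), of "complex_of_real r" k x] r z
    by (simp add: norm_scaleC norm_power)
  then have st: "summable (\<lambda>n. z ^ n *\<^sub>C ?t n)"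
    by (rule summable_norm_cancel)
  have "resolvent_term T k (complex_of_real r / z) x = (\<lambda>n. z ^ k *\<^sub>C z ^ n *\<^sub>C ?t n)"
    by (simp add: fun_eq_iff resolvent_term_def scaleC_scaleC power_add power_mult_distrib
        divide_inverse mult_ac)
  moreover have "\<dots> sums (z ^ k *\<^sub>C (\<Sum>n. z ^ n *\<^sub>C ?t n))"
    by (intro bounded_linear.sums[OF bounded_linear_scaleC] summable_sums st)
  moreover have "resolvent_term T k (complex_of_real r / z) x sums
      (resolvent T (complex_of_real r / z) ^^ k) x"
    using r z by (intro resolvent_power_sums T) (simp add: norm_divide)
  ultimately have "(resolvent T (complex_of_real r / z) ^^ k) x = z ^ k *\<^sub>C (\<Sum>n. z ^ n *\<^sub>C ?t n)"
    using sums_unique2 by metis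
  then show ?thesis
    using z by (simp add: norm_scaleC norm_power)
qed

section \<open>The equivalence\<close>

lemma resolvent_bound_of_power_decay:
  fixes T S :: "'a::complex_hilbert_space \<Rightarrow> 'a" and \<alpha> :: real and k :: nat
  assumes T: "bounded_clinear T" "power_bounded T" and S: "bounded_clinear S"
    and \<alpha>: "\<alpha> > 0" "real k > \<alpha>"
    and decay: "(\<lambda>n. onorm (T ^^ n \<circ> S)) \<in> O(\<lambda>n. real n powr (- \<alpha>))"
  shows "\<exists>M>0. \<forall>l. cmod l > 1 \<longrightarrow>
    onorm (resolvent T l ^^ k \<circ> S) \<le> M / (cmod l - 1) powr (real k - \<alpha>)"
proof -
  define b where "b = real k - \<alpha>"
  have b: "b > 0" and k: "real k > 0"
    using \<alpha> by (auto simp: b_def)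
  have blT: "bounded_linear T" and blS: "bounded_linear S"
    using T S by (auto simp: bounded_clinear_def)
  have bl: "bounded_linear (T ^^ n \<circ> S)" for n
    using bounded_linear_compose[OF bounded_linear_funpow[OF blT] blS] by (simp add: o_def)
  have "(\<lambda>n. rising_coeff (real k) n * onorm (T ^^ n \<circ> S))
      \<in> O(\<lambda>n. real n powr (real k - 1) * real n powr (- \<alpha>))"
    by (intro landau_o.big.mult decay bigthetaD1 rising_coeff_bigtheta k)
  also have "(\<lambda>n. real n powr (real k - 1) * real n powr (- \<alpha>)) = (\<lambda>n. real n powr (b - 1))"
    by (simp add: b_def algebra_simps flip: powr_add)
  also have "(\<lambda>n. real n powr (b - 1)) \<in> O(rising_coeff b)"
    using rising_coeff_bigtheta[OF b] by (simp add: bigtheta_sym bigthetaD1)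
  finally have "(\<lambda>n. rising_coeff (real k) n * onorm (T ^^ n \<circ> S)) \<in> O(rising_coeff b)" .
  then obtain A where A: "A > 0"
    and le: "\<And>n. \<bar>rising_coeff (real k) n * onorm (T ^^ n \<circ> S)\<bar> \<le> A * rising_coeff b n"
    using bigo_imp_bounded_all rising_coeff_pos[OF b] by blast
  have "onorm (resolvent T l ^^ k \<circ> S) \<le> A / (cmod l - 1) powr b" if l: "cmod l > 1" for l
  proof (rule onorm_bound)
    fix x
    define q where "q = inverse (cmod l)"
    have q: "0 < q" "q < 1"
      using l by (auto simp: q_def inverse_less_1_iff)
    have term_le: "norm (resolvent_term T k l (S x) n)
        \<le> rising_coeff b n * q ^ n * (A * q ^ k * norm x)" for n
    proof -
      have "rising_coeff (real k) n * norm ((T ^^ n) (S x))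
          \<le> rising_coeff (real k) n * (onorm (T ^^ n \<circ> S) * norm x)"
        using onorm[OF bl, of n x] by (intro mult_left_mono) (auto simp: rising_coeff_nonneg)
      also have "\<dots> \<le> A * rising_coeff b n * norm x"
        using le[of n] by (simp add: mult.assoc[symmetric] mult_right_mono)
      finally have "q ^ (n + k) * (rising_coeff (real k) n * norm ((T ^^ n) (S x)))
          \<le> q ^ (n + k) * (A * rising_coeff b n * norm x)"
        using q by (intro mult_left_mono) auto
      then show ?thesis
        by (simp add: norm_resolvent_term q_def[symmetric] power_add mult_ac)
    qed
    have sums: "(\<lambda>n. rising_coeff b n * q ^ n * (A * q ^ k * norm x)) sums
        ((1 - q) powr (- b) * (A * q ^ k * norm x))"
      using q by (intro sums_mult2 rising_coeff_sums) auto
    have sn: "summable (\<lambda>n. norm (resolvent_term T k l (S x) n))"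
      by (rule summable_norm_resolvent_term[OF blT T(2) l])
    have "norm ((resolvent T l ^^ k \<circ> S) x) = norm (suminf (resolvent_term T k l (S x)))"
      using sums_unique[OF resolvent_power_sums[OF T l, of k "S x"]] by simp
    also have "\<dots> \<le> (\<Sum>n. norm (resolvent_term T k l (S x) n))"
      by (rule summable_norm[OF sn])
    also have "\<dots> \<le> (1 - q) powr (- b) * (A * q ^ k * norm x)"
      using suminf_le[OF term_le sn sums_summable[OF sums]] sums_unique[OF sums] by simp
    also have "\<dots> = (1 - q) powr (- b) * q ^ k * (A * norm x)"
      by simp
    \<comment> \<open>With \<open>q = 1 / cmod l\<close>, the powers of \<open>cmod l\<close>
      combine to exponent \<open>b - k = - \<alpha>\<close>; this factor is at most 1 and is dropped
      next.\<close>
    also have "(1 - q) powr (- b) * q ^ k = cmod l powr (- \<alpha>) * (cmod l - 1) powr (- b)"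
    proof -
      have "1 - q = (cmod l - 1) / cmod l"
        using l by (subst diff_divide_distrib) (auto simp: q_def inverse_eq_divide)
      then have "(1 - q) powr (- b) = (cmod l - 1) powr (- b) * cmod l powr b"
        using l by (simp add: powr_divide) (simp add: powr_minus divide_inverse)
      moreover have "q ^ k = cmod l powr (- real k)"
        using powr_realpow[of "cmod l" k] l by (simp add: q_def powr_minus power_inverse del: zero_less_norm_iff)
      ultimately show ?thesis
        by (simp add: b_def flip: powr_add)
    qed
    also have "cmod l powr (- \<alpha>) * (cmod l - 1) powr (- b) * (A * norm x)
        \<le> 1 * (cmod l - 1) powr (- b) * (A * norm x)"
      using A \<alpha> l
      by (intro mult_right_mono) (auto simp: powr_minus inverse_le_1_iff ge_one_powr_ge_zero)
    finally show "norm ((resolvent T l ^^ k \<circ> S) x) \<le> A / (cmod l - 1) powr b * norm x"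
      by (simp add: powr_minus divide_inverse mult_ac)
  qed (use A in simp)
  then show ?thesis
    using A by (auto simp: b_def)
qed

lemma power_decay_of_resolvent_bound:
  fixes T S :: "'a::complex_hilbert_space \<Rightarrow> 'a" and \<alpha> :: real and k :: nat
  assumes T: "bounded_clinear T" "power_bounded T"
    and S: "bounded_clinear S" "S \<circ> T = T \<circ> S"
    and M: "M > 0"
    and res: "\<And>l. cmod l > 1 \<Longrightarrow>
      onorm (resolvent T l ^^ k \<circ> S) \<le> M / (cmod l - 1) powr (real k - \<alpha>)"
  shows "(\<lambda>n. onorm (T ^^ n \<circ> S)) \<in> O(\<lambda>n. real n powr (- \<alpha>))"
proof -
  have blT: "bounded_linear T" and blS: "bounded_linear S"
    using T S by (auto simp: bounded_clinear_def)
  obtain C where C: "C > 0" "\<And>n x. norm ((T ^^ n) x) \<le> C * norm x"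
    using power_bounded_norm_le[OF blT T(2)] by metis
  \<comment> \<open>The weights with parameter \<open>k + 1\<close> sum up to the coefficient with
    parameter \<open>k'\<close>, which grows like \<open>n powr (k' - 1)\<close>.\<close>
  define k' where "k' = real k + 2"
  have "(\<lambda>n. real n powr (k' - 1)) \<in> O(rising_coeff k')"
    using rising_coeff_bigtheta[of k'] by (simp add: k'_def bigtheta_sym bigthetaD1)
  then obtain A where A: "A > 0" "\<And>n. \<bar>real n powr (k' - 1)\<bar> \<le> A * rising_coeff k' n"
    by (rule bigo_imp_bounded_all) (auto simp: k'_def rising_coeff_pos)
  \<comment> \<open>An upper bound for \<open>r ^ (n + Suc k)\<close> with
    \<open>r = 1 + 1/N\<close> and \<open>n \<le> N\<close>: \<open>r ^ N\<close> is at most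
    \<open>exp 1\<close>, and \<open>r\<close> is at most 2.\<close>
  define D :: real where "D = exp 1 * 2 ^ Suc k"
  have D: "D > 0"
    by (simp add: D_def)
  have main: "norm ((T ^^ N) (S x)) \<le> A * (2 * C\<^sup>2 * D * M) * real N powr (- \<alpha>) * norm x"
    if N: "N \<ge> 1" for N x
  proof -
    define r where "r = 1 + 1 / real N"
    \<comment> \<open>The assumed resolvent bound on the circle of radius \<open>r\<close>, where
      \<open>r - 1 = 1/N\<close>.\<close>
    define B where "B = M * real N powr (real k - \<alpha>)"
    define u where "u = resolvent_term T 1 (complex_of_real r) x"
    define v where "v = resolvent_term T (Suc k) (complex_of_real r) (S x)"
    have r: "r > 1" "r \<le> 2" "r - 1 = 1 / real N"
      using N by (auto simp: r_def)
    then have cr: "cmod (complex_of_real r) > 1"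
      by simp
    have B: "B \<ge> 0"
      using M by (simp add: B_def)
    have le: "norm (\<Sum>n. z ^ n *\<^sub>C v n) \<le> B * norm (\<Sum>n. z ^ n *\<^sub>C u n)" if z: "cmod z = 1" for z
    proof -
      let ?l = "complex_of_real r / z"
      have l: "cmod ?l = r" "cmod ?l > 1"
        using r z by (auto simp: norm_divide)
      have "bounded_linear (resolvent T ?l)"
        using bounded_clinear_resolvent[OF T l(2)] by (simp add: bounded_clinear_def)
      then have bl: "bounded_linear (resolvent T ?l ^^ k \<circ> S)"
        using bounded_linear_compose[OF bounded_linear_funpow blS] by (simp add: o_def)
      have "norm (\<Sum>n. z ^ n *\<^sub>C v n) = norm ((resolvent T ?l ^^ Suc k) (S x))"
        unfolding v_def by (rule norm_resolvent_power_on_circle[OF T r(1) z])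
      also have "\<dots> = norm ((resolvent T ?l ^^ k \<circ> S) (resolvent T ?l x))"
        \<comment> \<open>Commutation moves one resolvent factor past \<open>S\<close> onto
          \<open>x\<close>, where it becomes the series of \<open>u\<close>.\<close>
        by (simp only: funpow_Suc_right o_apply resolvent_commute[OF T l(2) S])
      also have "\<dots> \<le> onorm (resolvent T ?l ^^ k \<circ> S) * norm (resolvent T ?l x)"
        by (rule onorm[OF bl])
      also have "\<dots> \<le> M / (r - 1) powr (real k - \<alpha>) * norm (resolvent T ?l x)"
        using res[OF l(2)] unfolding l(1) by (intro mult_right_mono) auto
      also have "M / (r - 1) powr (real k - \<alpha>) = B"
        using N by (simp add: r(3) B_def powr_divide)
      also have "norm (resolvent T ?l x) = norm (\<Sum>n. z ^ n *\<^sub>C u n)"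
        unfolding u_def using norm_resolvent_power_on_circle[OF T r(1) z, of 1 x] by simp
      finally show ?thesis .
    qed
    have U: "(\<Sum>n<m. (norm (u n))\<^sup>2) \<le> real N * (C * norm x)\<^sup>2" for m
    proof -
      define q where "q = inverse r"
      have q: "0 < q" "q < 1"
        using r by (auto simp: q_def inverse_less_1_iff)
      have "(norm (u n))\<^sup>2 \<le> q ^ n * (q * (C * norm x)\<^sup>2)" for n
      proof -
        have "norm (u n) \<le> q ^ Suc n * (C * norm x)"
          using r q C(2)[of n x]
          by (simp add: u_def norm_resolvent_term q_def[symmetric] mult_left_mono)
        then have "(norm (u n))\<^sup>2 \<le> (q ^ Suc n * (C * norm x))\<^sup>2"
          by (rule power_mono) simp
        also have "\<dots> = (q ^ Suc n)\<^sup>2 * (C * norm x)\<^sup>2"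
          by (simp add: power_mult_distrib)
        \<comment> \<open>Giving up the square costs little and makes the geometric sum exact:
          \<open>q / (1 - q) = N\<close>.\<close>
        also have "(q ^ Suc n)\<^sup>2 \<le> q ^ Suc n"
          unfolding power_mult[symmetric] using q by (intro power_decreasing) auto
        finally show ?thesis
          by (simp add: mult_right_mono mult_ac)
      qed
      then have "(\<Sum>n<m. (norm (u n))\<^sup>2) \<le> (\<Sum>n<m. q ^ n * (q * (C * norm x)\<^sup>2))"
        by (rule sum_mono)
      also have "\<dots> \<le> (\<Sum>n. q ^ n) * (q * (C * norm x)\<^sup>2)"
        unfolding sum_distrib_right[symmetric] using q
        by (intro mult_right_mono sum_le_suminf summable_geometric) auto
      also have "(\<Sum>n. q ^ n) = 1 / (1 - q)"
        using q by (intro suminf_geometric) auto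
      also have "1 / (1 - q) * (q * (C * norm x)\<^sup>2) = real N * (C * norm x)\<^sup>2"
      proof -
        have "1 / (1 - q) * q = real N"
          using N by (simp add: q_def r_def field_simps)
        then show ?thesis
          by (simp add: mult.assoc[symmetric])
      qed
      finally show ?thesis .
    qed
    have sq: "(\<Sum>n<Suc N. (norm (v n))\<^sup>2) \<le> B\<^sup>2 * (real N * (C * norm x)\<^sup>2)"
      by (rule plancherel_comparison[where u = u])
         (use le U B in \<open>auto simp: u_def v_def intro!: summable_norm_resolvent_term[OF blT T(2) cr]\<close>)
    have sum_v: "(\<Sum>n<Suc N. norm (v n)) \<le> 2 * (real N * B * (C * norm x))"
    proof (rule power2_le_imp_le)
      have "(\<Sum>n<Suc N. norm (v n))\<^sup>2 \<le> real (Suc N) * (\<Sum>n<Suc N. (norm (v n))\<^sup>2)"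
        using Cauchy_Schwarz_ineq_sum[of "\<lambda>_. 1" "\<lambda>n. norm (v n)" "{..<Suc N}"] by simp
      \<comment> \<open>The crude bound \<open>N + 1 \<le> 4 * N\<close> is chosen to make the
        right-hand side a perfect square.\<close>
      also have "\<dots> \<le> (4 * real N) * (B\<^sup>2 * (real N * (C * norm x)\<^sup>2))"
        using N by (intro mult_mono sq) (auto intro!: sum_nonneg add_nonneg_nonneg)
      also have "\<dots> = (2 * (real N * B * (C * norm x)))\<^sup>2"
        by (simp add: power2_eq_square)
      finally show "(\<Sum>n<Suc N. norm (v n))\<^sup>2 \<le> (2 * (real N * B * (C * norm x)))\<^sup>2" .
    qed (use B C(1) in simp)
    \<comment> \<open>One factor \<open>C\<close> comes from
      \<open>T ^^ N = T ^^ (N - n) \<circ> T ^^ n\<close>, and \<open>D\<close> compensates the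
      damping \<open>inverse r ^ (n + Suc k)\<close> contained in \<open>v n\<close>.\<close>
    have term_le: "rising_coeff (real (Suc k)) n * norm ((T ^^ N) (S x)) \<le> C * D * norm (v n)"
      if "n < Suc N" for n
    proof -
      let ?c = "rising_coeff (real (Suc k)) n"
      have c: "?c \<ge> 0"
        by (rule rising_coeff_nonneg) simp
      have "(T ^^ N) (S x) = (T ^^ (N - n)) ((T ^^ n) (S x))"
        using that by (simp flip: funpow_add comp_apply[of "T ^^ (N - n)" "T ^^ n"])
      then have 1: "norm ((T ^^ N) (S x)) \<le> C * norm ((T ^^ n) (S x))"
        using C(2) by simp
      have "r ^ N \<le> exp (1 / real N) ^ N"
        using exp_ge_add_one_self[of "1 / real N"] r by (intro power_mono) (auto simp: r_def)
      also have "\<dots> = exp 1"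
        using N by (simp flip: exp_of_nat_mult)
      finally have "r ^ N \<le> exp 1" .
      moreover have "r ^ n \<le> r ^ N"
        using r that by (intro power_increasing) auto
      ultimately have "r ^ (n + Suc k) \<le> D"
        unfolding power_add D_def using r by (intro mult_mono power_mono) (auto intro: order_trans simp del: power_increasing_iff)
      then have "1 \<le> D * inverse r ^ (n + Suc k)"
        using r(1) by (simp only: power_inverse flip: divide_inverse) simp
      then have "?c * (C * norm ((T ^^ n) (S x))) * 1
          \<le> ?c * (C * norm ((T ^^ n) (S x))) * (D * inverse r ^ (n + Suc k))"
        using c C(1) by (intro mult_left_mono) auto
      also have "\<dots> = C * D * norm (v n)"
        using r by (simp only: v_def norm_resolvent_term) (simp add: mult_ac)
      finally have "?c * (C * norm ((T ^^ n) (S x))) \<le> C * D * norm (v n)"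
        by simp
      then show ?thesis
        using mult_left_mono[OF 1 c] by linarith
    qed
    have "rising_coeff k' N * norm ((T ^^ N) (S x))
        = (\<Sum>n<Suc N. rising_coeff (real (Suc k)) n * norm ((T ^^ N) (S x)))"
      unfolding sum_distrib_right[symmetric] sum_rising_coeff by (simp add: k'_def add_ac)
    also have "\<dots> \<le> (\<Sum>n<Suc N. C * D * norm (v n))"
      by (intro sum_mono term_le) simp
    also have "\<dots> \<le> C * D * (2 * (real N * B * (C * norm x)))"
      unfolding sum_distrib_left[symmetric] using C(1) D by (intro mult_left_mono sum_v) auto
    finally have "A * (rising_coeff k' N * norm ((T ^^ N) (S x)))
        \<le> A * (C * D * (2 * (real N * B * (C * norm x))))"
      using A(1) by (intro mult_left_mono) auto
    moreover have "real N powr (k' - 1) * norm ((T ^^ N) (S x))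
        \<le> A * rising_coeff k' N * norm ((T ^^ N) (S x))"
      using A(2)[of N] by (intro mult_right_mono) auto
    ultimately have "real N powr (k' - 1) * norm ((T ^^ N) (S x))
        \<le> A * (C * D * (2 * (real N * B * (C * norm x))))"
      by (simp add: mult.assoc)
    \<comment> \<open>Splitting off \<open>N powr (k' - 1)\<close> exposes a factor common to both
      sides; cancelling it leaves the decay \<open>N powr (- \<alpha>)\<close>.\<close>
    also have "real N * B = M * (real N powr (k' - 1) * real N powr (- \<alpha>))"
    proof -
      have "real N powr (k' - 1) * real N powr (- \<alpha>) = real N powr (1 + (real k - \<alpha>))"
        by (simp add: k'_def add_diff_eq flip: powr_add)
      then show ?thesis
        using N by (simp add: powr_add B_def)
    qed
    also have "A * (C * D * (2 * (M * (real N powr (k' - 1) * real N powr (- \<alpha>)) * (C * norm x))))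
        = real N powr (k' - 1) * (A * (2 * C\<^sup>2 * D * M) * real N powr (- \<alpha>) * norm x)"
      by (simp add: power2_eq_square)
    finally show ?thesis
      by (rule mult_left_le_imp_le) (use N in simp)
  qed
  show ?thesis
  \<comment> \<open>The constant depends on neither \<open>N\<close> nor \<open>x\<close>, so the
    pointwise estimate passes to the operator norm; it starts at 1 because of the radius
    \<open>1 + 1/N\<close>.\<close>
  proof (rule bigoI[where c = "A * (2 * C\<^sup>2 * D * M)"], rule eventually_sequentiallyI[of 1])
    fix N :: nat assume N: "1 \<le> N"
    have "onorm (T ^^ N \<circ> S) \<le> A * (2 * C\<^sup>2 * D * M) * real N powr (- \<alpha>)"
      using main[OF N] A(1) C(1) D M by (intro onorm_bound) auto
    moreover have "onorm (T ^^ N \<circ> S) \<ge> 0"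
      using onorm_pos_le[OF bounded_linear_compose[OF bounded_linear_funpow[OF blT, of N] blS]]
      by (simp add: o_def)
    ultimately show "norm (onorm (T ^^ N \<circ> S)) \<le> A * (2 * C\<^sup>2 * D * M) * norm (real N powr (- \<alpha>))"
      by simp
  qed
qed

theorem theorem1p1:
  fixes T S :: "'a::complex_hilbert_space \<Rightarrow> 'a" and \<alpha> :: real and k :: nat
  assumes "bounded_clinear T" and "power_bounded T"
    and "bounded_clinear S" and "S \<circ> T = T \<circ> S"
    and "\<alpha> > 0" and "k \<ge> 1" and "real k > \<alpha>"
  shows "(\<lambda>n. onorm (T ^^ n \<circ> S)) \<in> O(\<lambda>n. real n powr (- \<alpha>)) \<longleftrightarrow>
    (\<exists>M>0. \<forall>l. cmod l > 1 \<longrightarrow>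
      onorm (resolvent T l ^^ k \<circ> S) \<le> M / (cmod l - 1) powr (real k - \<alpha>))"
  using resolvent_bound_of_power_decay[OF assms(1-3,5,7)]
    power_decay_of_resolvent_bound[OF assms(1-4)] by blast

end
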